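(* Let $x_0=(5,0)\in\mathbb{R}^2$, set $p_0:=y_0:=x_0$, and for every $k\in\mathbb{N}$ set $$p_{k+1}:=P_UP_V(p_k),\qquad x_{k+1}:=P_UP_V(y_k),\qquad y_{k+1}:=x_{k+1}+\alpha_k(x_{k+1}-x_k).$$ Let $p^*:=\lim_{k\to\infty}p_k$ and $x^*:=\lim_{k\to\infty}x_k$. Then $$(1,0)=p^*\neq x^*=\Bigl(\tfrac{19}{32},\tfrac{13}{32}\Bigr).$$
   Context: In $\mathbb{R}^2$ with the Euclidean inner product, $U:=\{(x_1,x_2)\in\mathbb{R}^2: x_1+x_2=1\}$, $V:=\mathbb{R}^2_+$ (the closed nonnegative quadrant), $P_U$ and $P_V$ are the orthogonal projections onto $U$ and $V$, $t_k:=\frac{k+2}{2}$ and $\alpha_k:=\frac{t_k-1}{t_{k+1}}=\frac{k}{k+3}$ for $k\in\mathbb{N}=\{0,1,2,\dots\}$. The existence of the two limits is to be understood as part of the assertion. *)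

theory Defs
  imports "HOL-Analysis.Analysis"
begin

definition lineU :: "(real^2) set" where
  "lineU = {x. x $ 1 + x $ 2 = 1}"

definition quadrantV :: "(real^2) set" where
  "quadrantV = {x. x $ 1 \<ge> 0 \<and> x $ 2 \<ge> 0}"

(* Both sets are nonempty, closed and convex, so closest_point is the orthogonal projection. *)

definition P_U :: "real^2 \<Rightarrow> real^2" where
  "P_U = closest_point lineU"

definition P_V :: "real^2 \<Rightarrow> real^2" where
  "P_V = closest_point quadrantV"

definition t :: "nat \<Rightarrow> real" where
  "t k = (real k + 2) / 2"

definition alpha :: "nat \<Rightarrow> real" where
  "alpha k = (t k - 1) / t (k + 1)"

lemma alpha_eq: "alpha k = real k / (real k + 3)"
  by (simp add: alpha_def t_def field_simps)

end

(* On the line U, with x_1 = a as parameter, P_U P_V acts as a \<mapsto> (a + 1)/2 for a \<ge> 1 and as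
   the identity for 0 \<le> a \<le> 1. Hence p_k decreases geometrically to (1,0). The momentum carries
   y_4 past (1,0) into the quadrant; from then on x_(k+1) = y_k, so the differences
   d_k = x_k - x_(k-1) satisfy d_(k+2) = k/(k+3) d_(k+1), are proportional to
   1/((k-1)k(k+1)), and telescope. *)
theory Submission
  imports Defs "HOL-Real_Asymp.Real_Asymp"
begin

text \<open>Turns the minimality condition of \<open>closest_point_unique\<close> into a polynomial
  inequality in coordinates.\<close>

lemma dist_le_real2:
  fixes x y z :: "real^2"
  shows "dist x y \<le> dist x z \<longleftrightarrow>
    (x $ 1 - y $ 1)\<^sup>2 + (x $ 2 - y $ 2)\<^sup>2 \<le> (x $ 1 - z $ 1)\<^sup>2 + (x $ 2 - z $ 2)\<^sup>2"
  by (simp add: dist_norm norm_vec_def L2_set_def sum_2)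

lemma closed_lineU: "closed lineU"
  unfolding lineU_def by (intro closed_Collect_eq continuous_intros)

lemma convex_lineU: "convex lineU"
proof (rule convexI)
  fix x y :: "real^2" and u v :: real
  assume "x \<in> lineU" "y \<in> lineU" "u + v = 1"
  then have "u * (x $ 1 + x $ 2) + v * (y $ 1 + y $ 2) = 1"
    by (simp add: lineU_def)
  then show "u *\<^sub>R x + v *\<^sub>R y \<in> lineU"
    by (simp add: lineU_def algebra_simps)
qed

lemma closed_quadrantV: "closed quadrantV"
  unfolding quadrantV_def by (intro closed_Collect_conj closed_Collect_le continuous_intros)

lemma convex_quadrantV: "convex quadrantV"
  by (rule convexI) (simp add: quadrantV_def)

text \<open>The quadrant is a product of two half-lines, so the squared distance is minimised in
  each coordinate separately.\<close>

lemma P_V_eq: "P_V x = vector [max 0 (x $ 1), max 0 (x $ 2)]"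
proof -
  have nearest: "(a - max 0 a)\<^sup>2 \<le> (a - b)\<^sup>2" if "0 \<le> b" for a b :: real
    using that by (auto simp: max_def abs_le_square_iff[symmetric])
  have "vector [max 0 (x $ 1), max 0 (x $ 2)] = closest_point quadrantV x"
    using nearest
    by (intro closest_point_unique convex_quadrantV closed_quadrantV)
       (auto simp: quadrantV_def dist_le_real2 intro!: add_mono)
  then show ?thesis by (simp add: P_V_def)
qed

text \<open>Pythagoras: for a point (c, d) of the line, its squared distance to (a, b) exceeds that
  of the foot by exactly its squared distance to the foot,
  \<open>2 * (c - (1 + a - b) / 2)^2\<close>.\<close>

lemma P_U_eq: "P_U x = vector [(1 + x $ 1 - x $ 2) / 2, (1 - x $ 1 + x $ 2) / 2]"
proof -
  have nearest: "(a - (1 + a - b) / 2)\<^sup>2 + (b - (1 - a + b) / 2)\<^sup>2 \<le> (a - c)\<^sup>2 + (b - d)\<^sup>2"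
    if "c + d = 1" for a b c d :: real
  proof -
    have d: "d = 1 - c" using that by simp
    have "(a - c)\<^sup>2 + (b - d)\<^sup>2 - ((a - (1 + a - b) / 2)\<^sup>2 + (b - (1 - a + b) / 2)\<^sup>2)
        = 2 * (c - (1 + a - b) / 2)\<^sup>2"
      unfolding d by (simp add: power2_eq_square field_simps)
    moreover have "0 \<le> 2 * (c - (1 + a - b) / 2)\<^sup>2" by simp
    ultimately show ?thesis by linarith
  qed
  have "vector [(1 + x $ 1 - x $ 2) / 2, (1 - x $ 1 + x $ 2) / 2] = closest_point lineU x"
    by (intro closest_point_unique convex_lineU closed_lineU)
       (use nearest in \<open>simp_all add: lineU_def dist_le_real2 add_divide_distrib diff_divide_distrib\<close>)
  then show ?thesis by (simp add: P_U_def)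
qed

definition line_pt :: "real \<Rightarrow> real^2" where
  "line_pt a = vector [a, 1 - a]"

lemma vec_eq_iff_2: "(x :: real^2) = y \<longleftrightarrow> x $ 1 = y $ 1 \<and> x $ 2 = y $ 2"
  by (simp add: vec_eq_iff forall_2)

lemma line_pt_eq_iff: "line_pt a = line_pt b \<longleftrightarrow> a = b"
  by (auto simp: line_pt_def vec_eq_iff_2)

lemma line_pt_extrapolate:
  "line_pt a + c *\<^sub>R (line_pt a - line_pt b) = line_pt (a + c * (a - b))"
  by (simp add: line_pt_def vec_eq_iff_2 algebra_simps)

lemma tendsto_line_pt: "(f \<longlongrightarrow> a) F \<Longrightarrow> ((\<lambda>n. line_pt (f n)) \<longlongrightarrow> line_pt a) F"
proof (rule vec_tendstoI)
  fix i :: 2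
  assume "(f \<longlongrightarrow> a) F"
  then show "((\<lambda>n. line_pt (f n) $ i) \<longlongrightarrow> line_pt a $ i) F"
    using exhaust_2[of i] by (auto simp: line_pt_def intro: tendsto_diff[OF tendsto_const])
qed

text \<open>Here 1 - a \<le> 0, so \<open>P_V\<close> yields (a, 0), and returning to the line
  halves the excess a - 1.\<close>

lemma P_U_P_V_line_pt_outside: "1 \<le> a \<Longrightarrow> P_U (P_V (line_pt a)) = line_pt ((a + 1) / 2)"
  by (simp add: P_U_eq P_V_eq line_pt_def vec_eq_iff_2 field_simps)

lemma P_U_P_V_line_pt_inside: "0 \<le> a \<Longrightarrow> a \<le> 1 \<Longrightarrow> P_U (P_V (line_pt a)) = line_pt a"
  by (simp add: P_U_eq P_V_eq line_pt_def vec_eq_iff_2)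

text \<open>The starting point is off the line U, so the first step needs its own computation; all
  later iterates have the form \<open>line_pt a\<close>.\<close>

lemma P_U_P_V_start: "P_U (P_V (vector [5, 0])) = line_pt 3"
  by (simp add: P_U_eq P_V_eq line_pt_def vec_eq_iff_2)

lemma tendsto_projection_iterates:
  fixes p :: "nat \<Rightarrow> real^2"
  assumes p_0: "p 0 = vector [5, 0]"
    and p_Suc: "\<And>k. p (Suc k) = P_U (P_V (p k))"
  shows "p \<longlonglongrightarrow> line_pt 1"
proof -
  \<comment> \<open>The excess over 1 is 3 - 1 = 2 after the first step and halves from then
    on.\<close>
  have "p (Suc n) = line_pt (1 + 2 * (1 / 2) ^ n)" for n
  proof (induction n)
    case 0
    show ?case by (simp add: p_Suc p_0 P_U_P_V_start)
  next
    case (Suc n)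
    have "p (Suc (Suc n)) = line_pt ((1 + 2 * (1 / 2) ^ n + 1) / 2)"
      unfolding p_Suc[of "Suc n"] Suc by (rule P_U_P_V_line_pt_outside) simp
    then show ?case by (simp add: add_divide_distrib)
  qed
  moreover have "(\<lambda>n. 1 + 2 * (1 / 2) ^ n) \<longlonglongrightarrow> (1 + 2 * 0 :: real)"
    by (intro tendsto_intros LIMSEQ_power_zero) simp
  ultimately have "(\<lambda>n. p (Suc n)) \<longlonglongrightarrow> line_pt 1"
    using tendsto_line_pt by fastforce
  then show ?thesis by (rule LIMSEQ_imp_Suc)
qed

text \<open>Closed form of the parameter of x_k for k \<ge> 4. The shape A + C/(k(k+1)) comes from
  telescoping; A and C are fixed by the values 17/16 at k = 4 and 29/32 at k = 5.\<close>

definition accel_coord :: "real \<Rightarrow> real" where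
  "accel_coord k = 19 / 32 + 75 / (8 * (k * (k + 1)))"

text \<open>Keeps the extrapolated points in the quadrant. The bound 5 is sharp among integers: the
  value at 4 is 17/16 > 1.\<close>

lemma accel_coord_bounds:
  assumes "5 \<le> k"
  shows "0 \<le> accel_coord k" and "accel_coord k \<le> 1"
proof -
  have "5 * 6 \<le> k * (k + 1)" using assms by (intro mult_mono) auto
  then have "75 / (8 * (k * (k + 1))) \<le> 75 / (8 * 30)" by (intro divide_left_mono) auto
  then show "accel_coord k \<le> 1" unfolding accel_coord_def by linarith
  show "0 \<le> accel_coord k" using assms by (simp add: accel_coord_def)
qed

text \<open>The increment from k to k + 1 is -75/(4k(k+1)(k+2)), so the ratio of the next increment
  to it is k/(k+3), which is \<open>alpha\<close> at k.\<close>

lemma accel_coord_recurrence: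
  assumes "0 < k"
  shows "accel_coord (k + 1) + k / (k + 3) * (accel_coord (k + 1) - accel_coord k)
    = accel_coord (k + 2)"
proof -
  have "k \<noteq> 0" "k + 1 \<noteq> 0" "k + 2 \<noteq> 0" "k + 3 \<noteq> 0" using assms by auto
  then show ?thesis
    \<comment> \<open>Reassociation turns k + 1 + 1 into k + 2, matching the nonvanishing
      facts.\<close>
    unfolding accel_coord_def add.assoc one_add_one
    by (simp add: divide_simps) (simp add: algebra_simps)
qed

lemma tendsto_accel_coord: "(\<lambda>n. accel_coord (real (n + 4))) \<longlonglongrightarrow> 19 / 32"
  unfolding accel_coord_def by real_asymp

lemma tendsto_accelerated_iterates:
  fixes x y :: "nat \<Rightarrow> real^2"
  assumes x_0: "x 0 = vector [5, 0]"
    and y_0: "y 0 = x 0"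
    and x_Suc: "\<And>k. x (Suc k) = P_U (P_V (y k))"
    and y_Suc: "\<And>k. y (Suc k) = x (Suc k) + alpha k *\<^sub>R (x (Suc k) - x k)"
  shows "x \<longlonglongrightarrow> line_pt (19 / 32)"
proof -
  have x1: "x 1 = line_pt 3"
    using x_Suc[of 0] by (simp add: y_0 x_0 P_U_P_V_start)
  \<comment> \<open>No momentum yet: \<open>alpha 0\<close> is 0.\<close>
  have y1: "y 1 = line_pt 3"
    using y_Suc[of 0] using x1 by (simp add: alpha_eq)
  have step: "x (Suc (Suc k)) = line_pt ((b + 1) / 2) \<and>
      y (Suc (Suc k)) = line_pt ((b + 1) / 2 + alpha (Suc k) * ((b + 1) / 2 - a))"
    if "x (Suc k) = line_pt a" "y (Suc k) = line_pt b" "1 \<le> b" for k a b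
    using that x_Suc[of "Suc k"] y_Suc[of "Suc k"]
    by (simp add: P_U_P_V_line_pt_outside line_pt_extrapolate)
  have 2: "x 2 = line_pt 2" "y 2 = line_pt (7 / 4)"
    using step[of 0 3 3] x1 y1 by (simp_all add: alpha_eq numeral_2_eq_2)
  have 3: "x 3 = line_pt (11 / 8)" "y 3 = line_pt (9 / 8)"
    using step[of 1 2 "7 / 4"] 2 by (simp_all add: alpha_eq eval_nat_numeral)
  \<comment> \<open>Last use of \<open>step\<close>: y_3 has parameter 9/8 \<ge> 1, whereas 29/32 <
    1 for y_4.\<close>
  have 4: "x 4 = line_pt (17 / 16)" "y 4 = line_pt (29 / 32)"
    using step[of 2 "11 / 8" "9 / 8"] 3 by (simp_all add: alpha_eq eval_nat_numeral)
  \<comment> \<open>The invariant records y_k as the future x_(k+1), since the projections now fix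
    y_k.\<close>
  have "x (n + 4) = line_pt (accel_coord (real (n + 4))) \<and>
      y (n + 4) = line_pt (accel_coord (real (n + 4) + 1))" for n
  proof (induction n)
    case 0
    show ?case by (simp add: 4 accel_coord_def)
  next
    case (Suc n)
    define k where "k = real (n + 4)"
    have k: "4 \<le> k" by (simp add: k_def)
    have x: "x (n + 4) = line_pt (accel_coord k)" and y: "y (n + 4) = line_pt (accel_coord (k + 1))"
      using Suc by (simp_all add: k_def)
    have x': "x (Suc (n + 4)) = line_pt (accel_coord (k + 1))"
      unfolding x_Suc y using k by (intro P_U_P_V_line_pt_inside accel_coord_bounds) auto
    have "y (Suc (n + 4)) = line_pt (accel_coord (k + 1)
        + k / (k + 3) * (accel_coord (k + 1) - accel_coord k))"
      unfolding y_Suc x x' line_pt_extrapolate alpha_eq k_def ..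
    also have "\<dots> = line_pt (accel_coord (k + 2))"
      using k by (subst accel_coord_recurrence) auto
    finally show ?case using x' by (simp add: k_def algebra_simps)
  qed
  then have "(\<lambda>n. x (n + 4)) \<longlonglongrightarrow> line_pt (19 / 32)"
    using tendsto_line_pt[OF tendsto_accel_coord] by presburger
  then show ?thesis by (rule LIMSEQ_offset)
qed

theorem mainTheorem3:
  fixes p x y :: "nat \<Rightarrow> real^2"
  assumes x_0: "x 0 = vector [5, 0]"
    and y_0: "y 0 = x 0"
    and p_0: "p 0 = y 0"
    and p_Suc: "\<And>k. p (k + 1) = P_U (P_V (p k))"
    and x_Suc: "\<And>k. x (k + 1) = P_U (P_V (y k))"
    and y_Suc: "\<And>k. y (k + 1) = x (k + 1) + alpha k *\<^sub>R (x (k + 1) - x k)"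
  shows "convergent p \<and> convergent x \<and>
    vector [1, 0] = lim p \<and> lim p \<noteq> lim x \<and> lim x = vector [19/32, 13/32]"
proof -
  have p: "p \<longlonglongrightarrow> line_pt 1"
    using x_0 y_0 p_0 p_Suc by (intro tendsto_projection_iterates) auto
  have x: "x \<longlonglongrightarrow> line_pt (19 / 32)"
    using x_0 y_0 x_Suc y_Suc by (intro tendsto_accelerated_iterates) auto
  have "line_pt 1 = vector [1, 0]" "line_pt (19 / 32) = vector [19 / 32, 13 / 32]"
    by (simp_all add: line_pt_def)
  moreover have "line_pt 1 \<noteq> line_pt (19 / 32)" by (simp add: line_pt_eq_iff)
  ultimately show ?thesis
    using p x limI[OF p] limI[OF x] by (auto simp: convergent_def)
qed

end
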